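(* Let $L$ be a completely solvable Lie algebra of dimension $n$ and let $P$ be a commutative Lie subalgebra of $L$ of dimension $p$. Then the following conditions are equivalent: (1) $P$ is a CP (resp. a CP-ideal) of $L$. (2) There exists a descending series of Lie subalgebras (resp. of ideals) of $L$, $$L = L_n \supset \cdots \supset L_{j+1}\supset L_j\supset\cdots\supset L_p = P,\qquad \dim L_j = j,$$ with increasing index, i.e. $i(L_j) = i(L_{j+1})+1$ for $j=p,\ldots,n-1$.
   Context: All Lie algebras are finite-dimensional over a field $k$ of characteristic zero. For a Lie algebra $L$ and $f\in L^*$, put $L(f)=\{x\in L\mid f([x,y])=0 \text{ for all } y\in L\}$. The index of $L$ is $i(L)=\min_{f\in L^*}\dim L(f)$. A polarization of $L$ with respect to $f\in L^*$ is a Lie subalgebra $P$ with $f([P,P])=0$ and $\dim P=\frac12(\dim L+\dim L(f))$. A CP (commutative polarization) of $L$ is a commutative Lie subalgebra $P$ which is a polarization with respect to some $f\in L^*$; equivalently, a commutative Lie subalgebra $P$ with $\dim P=\frac12(\dim L+i(L))$. A CP-ideal of $L$ is a CP of $L$ which is an ideal of $L$. $L$ is completely solvable if it has a chain of ideals $0=I_0\subset I_1\subset\cdots\subset I_n=L$ with $\dim I_j=j$. The parenthetical "resp." version of the theorem reads: $P$ is a CP-ideal if and only if there is such a series consisting of ideals of $L$. *)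

theory Defs
  imports Complex_Main
begin

(* A finite-dimensional Lie algebra over a field of characteristic zero, carried by a type.
   Its subalgebras are subsets of that type; the notions below take the underlying set L of the
   Lie algebra as an argument, so that they apply both to the whole algebra (L = UNIV) and to
   its subalgebras. *)
locale lie_algebra = vector_space scale
  for scale :: "'k::field_char_0 \<Rightarrow> 'a::ab_group_add \<Rightarrow> 'a" +
  fixes bracket :: "'a \<Rightarrow> 'a \<Rightarrow> 'a"
  assumes finite_dimensional: "\<exists>B. finite_dimensional_vector_space scale B"
    and linear_bracket_right: "Vector_Spaces.linear scale scale (\<lambda>y. bracket x y)"
    and linear_bracket_left: "Vector_Spaces.linear scale scale (\<lambda>x. bracket x y)"
    and bracket_self: "bracket x x = 0"
    and jacobi: "bracket x (bracket y z) + bracket y (bracket z x) + bracket z (bracket x y) = 0"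
begin

definition lie_subalgebra :: "'a set \<Rightarrow> bool" where
  "lie_subalgebra S \<longleftrightarrow> subspace S \<and> (\<forall>x\<in>S. \<forall>y\<in>S. bracket x y \<in> S)"

definition lie_ideal :: "'a set \<Rightarrow> 'a set \<Rightarrow> bool" where
  "lie_ideal L I \<longleftrightarrow> subspace I \<and> I \<subseteq> L \<and> (\<forall>x\<in>L. \<forall>y\<in>I. bracket x y \<in> I)"

definition commutative :: "'a set \<Rightarrow> bool" where
  "commutative S \<longleftrightarrow> (\<forall>x\<in>S. \<forall>y\<in>S. bracket x y = 0)"

(* Functionals are total functions that are linear on the subspace L; their values outside L
   are arbitrary and never used. *)
definition dual_space :: "'a set \<Rightarrow> ('a \<Rightarrow> 'k) set" where
  "dual_space L = {f. (\<forall>x\<in>L. \<forall>y\<in>L. f (x + y) = f x + f y) \<and>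
                      (\<forall>c. \<forall>x\<in>L. f (scale c x) = c * f x)}"

definition stabilizer :: "'a set \<Rightarrow> ('a \<Rightarrow> 'k) \<Rightarrow> 'a set" where
  "stabilizer L f = {x \<in> L. \<forall>y\<in>L. f (bracket x y) = 0}"

(* An infimum of a nonempty set of natural numbers is attained, so this is a minimum. *)
definition lie_index :: "'a set \<Rightarrow> nat" where
  "lie_index L = (INF f\<in>dual_space L. dim (stabilizer L f))"

definition polarization :: "'a set \<Rightarrow> ('a \<Rightarrow> 'k) \<Rightarrow> 'a set \<Rightarrow> bool" where
  "polarization L f P \<longleftrightarrow>
     lie_subalgebra P \<and> P \<subseteq> L \<and> (\<forall>x\<in>P. \<forall>y\<in>P. f (bracket x y) = 0) \<and>
     2 * dim P = dim L + dim (stabilizer L f)"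

definition CP :: "'a set \<Rightarrow> 'a set \<Rightarrow> bool" where
  "CP L P \<longleftrightarrow> lie_subalgebra P \<and> commutative P \<and> (\<exists>f\<in>dual_space L. polarization L f P)"

definition CP_ideal :: "'a set \<Rightarrow> 'a set \<Rightarrow> bool" where
  "CP_ideal L P \<longleftrightarrow> CP L P \<and> lie_ideal L P"

definition completely_solvable :: "'a set \<Rightarrow> bool" where
  "completely_solvable L \<longleftrightarrow>
     (\<exists>I :: nat \<Rightarrow> 'a set. I 0 = {0} \<and> I (dim L) = L \<and>
        (\<forall>j\<le>dim L. lie_ideal L (I j) \<and> dim (I j) = j) \<and>
        (\<forall>j<dim L. I j \<subset> I (Suc j)))"

end

end

theory Submission
  imports Defs
begin

text \<open>
  For a subspace \<open>M\<close> of \<open>V\<close> and a bilinear form on \<open>V\<close> one has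
  \<open>dim M\<^sup>\<bottom> + dim M \<le> dim V + dim V\<^sup>\<bottom>\<close>. Applied to the forms \<open>f [x, y]\<close>, this gives both
  \<open>2 dim P \<le> dim V + i(V)\<close> for a commutative subalgebra \<open>P\<close> of \<open>V\<close> and
  \<open>i(V) + dim V \<le> dim L + i(L)\<close> for a subalgebra \<open>V\<close> of \<open>L\<close>. Hence if \<open>P\<close> is a CP, then
  \<open>i(V) = 2 dim P - dim V\<close> for every subalgebra \<open>V\<close> between \<open>P\<close> and \<open>L\<close>, and any maximal chain of
  such subalgebras will do. The sums \<open>P + I\<^sub>j\<close> over the ideals of a complete flag provide one.
  Conversely, \<open>i(P) = dim P\<close>, so along a chain with increasing index \<open>2 dim P = dim L + i(L)\<close>.
\<close>

section \<open>Linear algebra: orthogonals of a bilinear form, and flags\<close>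

context finite_dimensional_vector_space
begin

text \<open>Any \<open>v\<close> in \<open>S\<close> with \<open>g v \<noteq> 0\<close> spans
  \<open>S\<close> together with the kernel. Linearity is asked on \<open>S\<close> only, since
  functionals in a \<open>dual_space\<close> are arbitrary elsewhere.\<close>

lemma dim_le_Suc_dim_kernel:
  assumes "subspace S"
    and add: "\<And>x y. x \<in> S \<Longrightarrow> y \<in> S \<Longrightarrow> g (x + y) = g x + g y"
    and scale: "\<And>c x. x \<in> S \<Longrightarrow> g (scale c x) = c * (g x :: 'a)"
  shows "dim S \<le> Suc (dim {x \<in> S. g x = 0})"
proof (cases "\<forall>x\<in>S. g x = 0")
  case True
  then have "{x \<in> S. g x = 0} = S" by auto
  then show ?thesis by simp
next
  case False
  then obtain v where v: "v \<in> S" "g v \<noteq> 0" by auto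
  let ?K = "{x \<in> S. g x = 0}"
  have "x \<in> span (insert v ?K)" if x: "x \<in> S" for x
  proof -
    let ?c = "g x / g v"
    let ?y = "x + scale (- ?c) v"
    have cv: "scale (- ?c) v \<in> S" using assms(1) v(1) by (rule subspace_scale)
    have "g ?y = 0" using add[OF x cv] scale[OF v(1), of "- ?c"] v(2) by simp
    moreover have "?y \<in> S" using assms(1) x cv by (rule subspace_add)
    ultimately have "?y \<in> span (insert v ?K)" by (intro span_base) simp
    moreover have "scale ?c v \<in> span (insert v ?K)"
      by (intro span_scale span_base) simp
    ultimately have "?y + scale ?c v \<in> span (insert v ?K)" by (rule span_add)
    then show ?thesis by simp
  qed
  then have "dim S \<le> dim (insert v ?K)" by (intro dim_mono) auto
  also have "\<dots> \<le> Suc (dim ?K)" by (simp add: dim_insert)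
  finally show ?thesis .
qed

text \<open>Induction on the codimension of \<open>M\<close>, starting from \<open>M = V\<close>,
  where both sides agree. Adjoining a vector to \<open>M\<close> imposes one linear condition on its
  orthogonal, which loses at most one dimension while \<open>M\<close> gains one; so the left side
  never decreases as \<open>M\<close> grows to \<open>V\<close>.\<close>

lemma dim_orthogonal_le:
  assumes V: "subspace V" and "subspace M" "M \<subseteq> V"
    and addl: "\<And>x y z. x \<in> V \<Longrightarrow> y \<in> V \<Longrightarrow> z \<in> V \<Longrightarrow> b (x + y) z = b x z + b y z"
    and scalel: "\<And>c x z. x \<in> V \<Longrightarrow> z \<in> V \<Longrightarrow> b (scale c x) z = c * (b x z :: 'a)"
    and addr: "\<And>x y z. x \<in> V \<Longrightarrow> y \<in> V \<Longrightarrow> z \<in> V \<Longrightarrow> b z (x + y) = b z x + b z y"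
    and scaler: "\<And>c x z. x \<in> V \<Longrightarrow> z \<in> V \<Longrightarrow> b z (scale c x) = c * b z x"
  shows "dim {x \<in> V. \<forall>y\<in>M. b x y = 0} + dim M \<le> dim V + dim {x \<in> V. \<forall>y\<in>V. b x y = 0}"
  using assms(2,3)
proof (induction "dim V - dim M" arbitrary: M rule: less_induct)
  case less
  have zl: "b 0 z = 0" if "z \<in> V" for z
    using scalel[of 0 z 0] subspace_0[OF V] that by simp
  have zr: "b z 0 = 0" if "z \<in> V" for z
    using scaler[of 0 z 0] subspace_0[OF V] that by simp
  show ?case
  proof (cases "M = V")
    case True
    then show ?thesis by simp
  next
    case False
    with less.prems obtain v where v: "v \<in> V" "v \<notin> M" by auto
    define M' where "M' = span (insert v M)"
    have M': "subspace M'" "M' \<subseteq> V"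
      unfolding M'_def using less.prems(2) v(1) V by (simp_all add: span_minimal)
    have dM': "dim M' = Suc (dim M)"
      unfolding M'_def using v(2) less.prems(1) by (simp add: dim_insert span_eq_iff[THEN iffD2])
    let ?N = "{x \<in> V. \<forall>y\<in>M. b x y = 0}"
    have "subspace ?N"
    proof (rule subspaceI)
      show "0 \<in> ?N" using subspace_0[OF V] zl less.prems(2) by auto
      show "x + y \<in> ?N" if "x \<in> ?N" "y \<in> ?N" for x y
        using that subspace_add[OF V] less.prems(2) by (auto simp: addl subset_iff)
      show "scale c x \<in> ?N" if "x \<in> ?N" for c x
        using that subspace_scale[OF V] less.prems(2) by (auto simp: scalel subset_iff)
    qed
    then have "dim ?N \<le> Suc (dim {x \<in> ?N. b x v = 0})"
      by (rule dim_le_Suc_dim_kernel) (use v(1) in \<open>auto simp: addl scalel\<close>)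
    moreover have "{x \<in> ?N. b x v = 0} \<subseteq> {x \<in> V. \<forall>y\<in>M'. b x y = 0}"
    proof safe
      fix x y
      assume x: "x \<in> V" "\<forall>y\<in>M. b x y = 0" "b x v = 0" and y: "y \<in> M'"
      \<comment> \<open>For fixed \<open>x\<close> these \<open>y\<close> form a subspace, so
        vanishing on \<open>insert v M\<close> extends to the span \<open>M'\<close>.\<close>
      have "subspace {y \<in> V. b x y = 0}"
        using x(1) V zr by (auto intro!: subspaceI simp: addr scaler subspace_add subspace_scale subspace_0)
      then have "M' \<subseteq> {y \<in> V. b x y = 0}"
        unfolding M'_def using x v(1) less.prems(2) by (intro span_minimal) auto
      then show "b x y = 0" using y by auto
    qed
    then have "dim {x \<in> ?N. b x v = 0} \<le> dim {x \<in> V. \<forall>y\<in>M'. b x y = 0}"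
      by (rule dim_subset)
    moreover have "dim V - dim M' < dim V - dim M"
      using dM' dim_subset[OF M'(2)] by simp
    then have "dim {x \<in> V. \<forall>y\<in>M'. b x y = 0} + dim M' \<le> dim V + dim {x \<in> V. \<forall>y\<in>V. b x y = 0}"
      using M' by (rule less.hyps)
    ultimately show ?thesis using dM' by simp
  qed
qed

text \<open>A discrete intermediate value argument: dimensions that rise by at most one per step
  take every value from \<open>p\<close> to \<open>n\<close>. Choosing one index for each value
  removes the repetitions from \<open>J\<close>.\<close>

lemma flag_refinement:
  fixes J :: "nat \<Rightarrow> 'b set"
  assumes subspace: "\<And>i. i \<le> m \<Longrightarrow> subspace (J i)"
    and mono: "\<And>i. i < m \<Longrightarrow> J i \<subseteq> J (Suc i)"
    and step: "\<And>i. i < m \<Longrightarrow> dim (J (Suc i)) \<le> Suc (dim (J i))"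
    and p: "dim (J 0) = p" and n: "dim (J m) = n"
  obtains L where "L n = J m" "L p = J 0"
    "\<And>j. j \<in> {p..n} \<Longrightarrow> dim (L j) = j \<and> L j \<in> J ` {..m}"
    "\<And>j. j \<in> {p..<n} \<Longrightarrow> L j \<subset> L (j + 1)"
proof -
  have J_mono: "J i \<subseteq> J k" if "i \<le> k" "k \<le> m" for i k
    using that by (induction rule: dec_induct) (use mono in \<open>auto simp: subset_iff\<close>)
  have "\<exists>i\<le>k. dim (J i) = j" if "j \<in> {p..dim (J k)}" "k \<le> m" for j k
    using that
  proof (induction k)
    case 0
    then show ?case using p by auto
  next
    case (Suc k)
    then show ?case
    proof (cases "j \<le> dim (J k)")
      case True
      then show ?thesis using Suc by (auto intro: le_SucI)
    next
      case False
      then have "dim (J (Suc k)) = j" using Suc.prems step[of k] by auto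
      then show ?thesis by blast
    qed
  qed
  from this[of _ m] have "\<exists>i. \<forall>j\<in>{p..n}. i j \<le> m \<and> dim (J (i j)) = j"
    using n by (intro bchoice) auto
  then obtain i where i: "\<And>j. j \<in> {p..n} \<Longrightarrow> i j \<le> m" "\<And>j. j \<in> {p..n} \<Longrightarrow> dim (J (i j)) = j"
    by blast
  have pn: "p \<le> n" using dim_subset[OF J_mono[of 0 m]] p n by simp
  show ?thesis
  proof (rule that[of "\<lambda>j. J (i j)"])
    \<comment> \<open>The index chosen for \<open>n\<close> need not be \<open>m\<close>, but nested
      subspaces of equal dimension coincide; likewise for \<open>p\<close> and
      \<open>0\<close>.\<close>
    show "J (i n) = J m"
      using pn i[of n] n by (intro subspace_dim_equal subspace J_mono) auto
    show "J (i p) = J 0"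
      using pn i[of p] p by (intro subspace_dim_equal[symmetric] subspace J_mono) auto
    show "dim (J (i j)) = j \<and> J (i j) \<in> J ` {..m}" if "j \<in> {p..n}" for j
      using i[OF that] by auto
    show "J (i j) \<subset> J (i (j + 1))" if "j \<in> {p..<n}" for j
    proof -
      have j: "i j \<le> m" "i (j + 1) \<le> m" "dim (J (i j)) = j" "dim (J (i (j + 1))) = j + 1"
        using i[of j] i[of "j + 1"] that by auto
      \<comment> \<open>The choice of \<open>i\<close> is not monotone by construction. If
        \<open>i (j + 1)\<close> were at most \<open>i j\<close>, a space of dimension
        \<open>j + 1\<close> would lie in one of dimension \<open>j\<close>.\<close>
      then have "\<not> i (j + 1) \<le> i j" using dim_subset[OF J_mono[of "i (j + 1)" "i j"]] by auto
      then have "J (i j) \<subseteq> J (i (j + 1))" using j by (intro J_mono) auto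
      then show ?thesis using j by auto
    qed
  qed
qed

end

section \<open>The bracket, and sums with an ideal\<close>

context lie_algebra
begin

lemma finite_dimensionalE:
  obtains B where "finite_dimensional_vector_space scale B"
  using finite_dimensional by blast

lemma bracket_add_right: "bracket x (y + z) = bracket x y + bracket x z"
  using Vector_Spaces.linear_iff[of scale scale "bracket x"] linear_bracket_right[of x] by blast

lemma bracket_add_left: "bracket (x + y) z = bracket x z + bracket y z"
  using Vector_Spaces.linear_iff[of scale scale "\<lambda>x. bracket x z"] linear_bracket_left[of z] by blast

lemma bracket_scale_right: "bracket x (scale c y) = scale c (bracket x y)"
  using Vector_Spaces.linear_iff[of scale scale "bracket x"] linear_bracket_right[of x] by blast

lemma bracket_scale_left: "bracket (scale c x) y = scale c (bracket x y)"
  using Vector_Spaces.linear_iff[of scale scale "\<lambda>x. bracket x y"] linear_bracket_left[of y] by blast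

lemma bracket_skew: "bracket x y = - bracket y x"
proof -
  have "bracket (x + y) (x + y) = bracket x y + bracket y x"
    unfolding bracket_add_left bracket_add_right by (simp add: bracket_self)
  then show ?thesis by (simp add: bracket_self eq_neg_iff_add_eq_0)
qed

lemma lie_subalgebra_UNIV: "lie_subalgebra UNIV"
  by (simp add: lie_subalgebra_def)

text \<open>When the bracket of two sums is expanded, one term lies in \<open>S\<close> and the
  three that involve \<open>I\<close> lie in \<open>I\<close>.\<close>

lemma lie_subalgebra_plus_ideal:
  assumes "lie_subalgebra S" "lie_ideal UNIV I"
  shows "lie_subalgebra {x + y |x y. x \<in> S \<and> y \<in> I}"
  unfolding lie_subalgebra_def
proof (intro conjI ballI)
  show "subspace {x + y |x y. x \<in> S \<and> y \<in> I}"
    using assms by (intro subspace_sums) (auto simp: lie_subalgebra_def lie_ideal_def)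
  fix u v
  assume "u \<in> {x + y |x y. x \<in> S \<and> y \<in> I}" "v \<in> {x + y |x y. x \<in> S \<and> y \<in> I}"
  then obtain a b c d where u: "u = a + b" "a \<in> S" "b \<in> I" and v: "v = c + d" "c \<in> S" "d \<in> I"
    by blast
  have I: "subspace I" "\<And>x y. y \<in> I \<Longrightarrow> bracket x y \<in> I"
    using assms(2) by (auto simp: lie_ideal_def)
  have "bracket b c \<in> I"
    using I(2)[OF u(3), of c] subspace_neg[OF I(1)] bracket_skew[of b c] by simp
  then have "bracket a d + (bracket b c + bracket b d) \<in> I"
    using I u v by (intro subspace_add) auto
  moreover have "bracket a c \<in> S" using assms(1) u v by (auto simp: lie_subalgebra_def)
  moreover have "bracket u v = bracket a c + (bracket a d + (bracket b c + bracket b d))"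
    unfolding u v bracket_add_left bracket_add_right by (simp add: algebra_simps)
  ultimately show "bracket u v \<in> {x + y |x y. x \<in> S \<and> y \<in> I}" by blast
qed

lemma lie_ideal_plus_ideal:
  assumes "lie_ideal UNIV S" "lie_ideal UNIV I"
  shows "lie_ideal UNIV {x + y |x y. x \<in> S \<and> y \<in> I}"
  using assms unfolding lie_ideal_def
  by (auto simp: bracket_add_right intro!: subspace_sums) blast

section \<open>Functionals, the index, and its bounds\<close>

lemma dual_space_mono: "M \<subseteq> V \<Longrightarrow> dual_space V \<subseteq> dual_space M"
  unfolding dual_space_def by blast

text \<open>Lets commutativity give \<open>f (bracket x y) = 0\<close>: \<open>f\<close> is
  arbitrary outside \<open>V\<close>, but \<open>0\<close> lies in \<open>V\<close>.\<close>

lemma dual_space_zero: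
  assumes "f \<in> dual_space V" "lie_subalgebra V"
  shows "f 0 = 0"
proof -
  have "0 \<in> V" using assms(2) by (simp add: lie_subalgebra_def subspace_0)
  then have "f (scale 0 0) = 0 * f 0" using assms(1) unfolding dual_space_def by blast
  then show ?thesis by simp
qed

lemma lie_index_attained:
  obtains f where "f \<in> dual_space V" "lie_index V = dim (stabilizer V f)"
proof -
  have "(\<lambda>_. 0) \<in> dual_space V" by (simp add: dual_space_def)
  then have "lie_index V \<in> (\<lambda>f. dim (stabilizer V f)) ` dual_space V"
    unfolding lie_index_def by (intro Inf_nat_def1) auto
  then show ?thesis using that by auto
qed

lemma lie_index_le: "f \<in> dual_space V \<Longrightarrow> lie_index V \<le> dim (stabilizer V f)"
  unfolding lie_index_def by (rule cINF_lower) auto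

text \<open>The form is \<open>f (bracket x y)\<close>, whose radical is the stabilizer. It is
  bilinear on \<open>V\<close> because \<open>V\<close> is closed under the bracket and
  \<open>f\<close> is linear there.\<close>

lemma dim_orthogonal_bracket_le:
  assumes V: "lie_subalgebra V" and M: "subspace M" "M \<subseteq> V" and f: "f \<in> dual_space V"
  shows "dim {x \<in> V. \<forall>y\<in>M. f (bracket x y) = 0} + dim M \<le> dim V + dim (stabilizer V f)"
proof -
  obtain B where "finite_dimensional_vector_space scale B" by (rule finite_dimensionalE)
  then interpret F: finite_dimensional_vector_space scale B .
  show ?thesis
    unfolding stabilizer_def
    by (rule F.dim_orthogonal_le)
       (use V M f in \<open>auto simp: lie_subalgebra_def dual_space_def bracket_add_left
          bracket_add_right bracket_scale_left bracket_scale_right\<close>)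
qed

text \<open>Take \<open>f\<close> attaining the index of \<open>V\<close>. It is also a functional
  on \<open>M\<close>, and its stabilizer in \<open>M\<close> lies in the orthogonal of
  \<open>M\<close> in \<open>V\<close>.\<close>

lemma lie_index_subalgebra_le:
  assumes V: "lie_subalgebra V" and M: "lie_subalgebra M" "M \<subseteq> V"
  shows "lie_index M + dim M \<le> dim V + lie_index V"
proof -
  obtain B where "finite_dimensional_vector_space scale B" by (rule finite_dimensionalE)
  then interpret F: finite_dimensional_vector_space scale B .
  obtain f where f: "f \<in> dual_space V" "lie_index V = dim (stabilizer V f)"
    by (rule lie_index_attained)
  have "lie_index M \<le> dim (stabilizer M f)"
    using f(1) dual_space_mono[OF M(2)] by (intro lie_index_le) auto
  also have "\<dots> \<le> dim {x \<in> V. \<forall>y\<in>M. f (bracket x y) = 0}"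
    using M(2) by (intro F.dim_subset) (auto simp: stabilizer_def)
  finally show ?thesis
    using dim_orthogonal_bracket_le[OF V _ M(2) f(1)] M(1) f(2) by (simp add: lie_subalgebra_def)
qed

text \<open>A commutative \<open>P\<close> is isotropic for every \<open>f\<close>, hence contained
  in its own orthogonal.\<close>

lemma commutative_dim_le_stabilizer:
  assumes V: "lie_subalgebra V" and P: "subspace P" "P \<subseteq> V" "commutative P"
    and f: "f \<in> dual_space V"
  shows "2 * dim P \<le> dim V + dim (stabilizer V f)"
proof -
  obtain B where "finite_dimensional_vector_space scale B" by (rule finite_dimensionalE)
  then interpret F: finite_dimensional_vector_space scale B .
  have "P \<subseteq> {x \<in> V. \<forall>y\<in>P. f (bracket x y) = 0}"
    using P dual_space_zero[OF f V] by (auto simp: commutative_def)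
  then have "dim P \<le> dim {x \<in> V. \<forall>y\<in>P. f (bracket x y) = 0}" by (rule F.dim_subset)
  then show ?thesis using dim_orthogonal_bracket_le[OF V P(1,2) f] by simp
qed

lemma commutative_dim_le_index:
  assumes "lie_subalgebra V" "subspace P" "P \<subseteq> V" "commutative P"
  shows "2 * dim P \<le> dim V + lie_index V"
  by (rule lie_index_attained[of V]) (use commutative_dim_le_stabilizer[OF assms] in auto)

lemma lie_index_commutative:
  assumes "lie_subalgebra P" "commutative P"
  shows "lie_index P = dim P"
proof (rule antisym)
  show "dim P \<le> lie_index P"
    using commutative_dim_le_index[of P P] assms by (simp add: lie_subalgebra_def)
  obtain B where "finite_dimensional_vector_space scale B" by (rule finite_dimensionalE)
  then interpret F: finite_dimensional_vector_space scale B .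
  have "lie_index P \<le> dim (stabilizer P (\<lambda>_. 0))"
    by (rule lie_index_le) (simp add: dual_space_def)
  also have "\<dots> \<le> dim P" by (rule F.dim_subset) (auto simp: stabilizer_def)
  finally show "lie_index P \<le> dim P" .
qed

text \<open>The bound on commutative subalgebras forces any \<open>f\<close> that \<open>P\<close>
  polarizes to have a stabilizer of minimal dimension. Conversely, every \<open>f\<close> attaining
  the index serves as witness.\<close>

lemma CP_iff_index:
  assumes "lie_subalgebra V" "lie_subalgebra P" "P \<subseteq> V" "commutative P"
  shows "CP V P \<longleftrightarrow> 2 * dim P = dim V + lie_index V"
proof
  assume "CP V P"
  then obtain f where f: "f \<in> dual_space V" "2 * dim P = dim V + dim (stabilizer V f)"
    by (auto simp: CP_def polarization_def)
  then show "2 * dim P = dim V + lie_index V"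
    using commutative_dim_le_index[of V P] lie_index_le[OF f(1)] assms
    by (simp add: lie_subalgebra_def)
next
  assume *: "2 * dim P = dim V + lie_index V"
  obtain f where f: "f \<in> dual_space V" "lie_index V = dim (stabilizer V f)"
    by (rule lie_index_attained)
  then show "CP V P"
    using assms dual_space_zero[OF f(1)] * by (auto simp: CP_def polarization_def commutative_def)
qed

text \<open>A squeeze: \<open>2 * dim P\<close> is at most \<open>dim V + lie_index V\<close>, which
  is at most \<open>dim W + lie_index W\<close>, and this equals \<open>2 * dim P\<close> by the CP
  property.\<close>

lemma CP_lie_index_between:
  assumes P: "lie_subalgebra P" "commutative P" and CP: "CP W P" and W: "lie_subalgebra W"
    and V: "lie_subalgebra V" "P \<subseteq> V" "V \<subseteq> W"
  shows "lie_index V + dim V = 2 * dim P"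
  using commutative_dim_le_index[OF V(1) _ V(2)] lie_index_subalgebra_le[OF W V(1,3)]
    CP_iff_index[of W P] assms by (auto simp: lie_subalgebra_def)

section \<open>Chains between \<open>P\<close> and the whole algebra\<close>

lemma CP_if_index_chain:
  assumes P: "lie_subalgebra P" "commutative P" "dim P = p" and n: "dim (UNIV :: 'a set) = n"
    and L: "L n = UNIV" "L p = P"
    and step: "\<And>j. j \<in> {p..<n} \<Longrightarrow> lie_index (L j) = lie_index (L (j + 1)) + 1"
  shows "CP UNIV P"
proof -
  obtain B where "finite_dimensional_vector_space scale B" by (rule finite_dimensionalE)
  then interpret F: finite_dimensional_vector_space scale B .
  have "p \<le> n" using F.dim_subset[of P UNIV] P(3) n by (simp del: F.dim_UNIV)
  \<comment> \<open>The invariant of the chain. It starts at \<open>P\<close>, whose index is its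
    dimension, and at \<open>j = n\<close> it is the dimension criterion for a CP.\<close>
  have "lie_index (L j) + j = 2 * p" if "p \<le> j" "j \<le> n" for j
    using that
  proof (induction rule: dec_induct)
    case base
    then show ?case using lie_index_commutative[OF P(1,2)] P(3) L(2) by simp
  next
    case (step j)
    then show ?case using assms(7)[of j] by simp
  qed
  from this[of n] have "2 * dim P = dim (UNIV :: 'a set) + lie_index UNIV"
    using \<open>p \<le> n\<close> L(1) P(3) n by (simp del: F.dim_UNIV)
  then show ?thesis using CP_iff_index[OF lie_subalgebra_UNIV P(1) _ P(2)] by blast
qed

text \<open>The sums of \<open>P\<close> with the members of a complete flag of ideals lead from
  \<open>P\<close> to the whole algebra, with repetitions to be removed. The ideal summand is kept
  in the conclusion, so that both the subalgebra and the ideal version can be read off.\<close>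

lemma completely_solvable_chain:
  assumes "completely_solvable UNIV" and P: "subspace P" "dim P = p"
    and n: "dim (UNIV :: 'a set) = n"
  obtains L where "L n = UNIV" "L p = P"
    "\<And>j. j \<in> {p..n} \<Longrightarrow> dim (L j) = j"
    "\<And>j. j \<in> {p..n} \<Longrightarrow> \<exists>I. lie_ideal UNIV I \<and> L j = {x + y |x y. x \<in> P \<and> y \<in> I}"
    "\<And>j. j \<in> {p..<n} \<Longrightarrow> L j \<subset> L (j + 1)"
proof -
  obtain B where "finite_dimensional_vector_space scale B" by (rule finite_dimensionalE)
  then interpret F: finite_dimensional_vector_space scale B .
  obtain I where I: "I 0 = {0}" "I n = UNIV"
      "\<And>j. j \<le> n \<Longrightarrow> lie_ideal UNIV (I j)" "\<And>j. j \<le> n \<Longrightarrow> dim (I j) = j"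
      "\<And>j. j < n \<Longrightarrow> I j \<subset> I (Suc j)"
    using assms(1) unfolding completely_solvable_def n by blast
  let ?J = "\<lambda>i. {x + y |x y. x \<in> P \<and> y \<in> I i}"
  have sub: "subspace (I j)" if "j \<le> n" for j
    using I(3)[OF that] by (simp add: lie_ideal_def)
  have J0: "?J 0 = P" using I(1) by auto
  have "x \<in> ?J n" for x
  proof -
    have "x = 0 + x \<and> 0 \<in> P \<and> x \<in> I n" using I(2) subspace_0[OF P(1)] by simp
    then show ?thesis by blast
  qed
  then have Jn: "?J n = UNIV" by blast
  \<comment> \<open>As the intersections with \<open>P\<close> can only grow with \<open>i\<close>,
    each sum exceeds the previous one by at most one dimension.\<close>
  have dimJ: "dim (?J i) + dim (P \<inter> I i) = p + i" if "i \<le> n" for i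
    using F.dim_sums_Int[OF P(1) sub[OF that]] I(4)[OF that] P(2) by simp
  show ?thesis
  proof (rule F.flag_refinement[of n ?J p n])
    show "subspace (?J i)" if "i \<le> n" for i
      using P(1) sub[OF that] by (rule subspace_sums)
    show "?J i \<subseteq> ?J (Suc i)" if "i < n" for i
      using I(5)[OF that] by blast
    show "dim (?J (Suc i)) \<le> Suc (dim (?J i))" if "i < n" for i
    proof -
      have "dim (P \<inter> I i) \<le> dim (P \<inter> I (Suc i))"
        using I(5)[OF that] by (intro F.dim_subset) blast
      then show ?thesis using dimJ[of i] dimJ[of "Suc i"] that by linarith
    qed
    show "dim (?J 0) = p" using J0 P(2) by simp
    show "dim (?J n) = n" unfolding Jn by (rule n)
    fix L
    assume L: "L n = ?J n" "L p = ?J 0"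
      "\<And>j. j \<in> {p..n} \<Longrightarrow> dim (L j) = j \<and> L j \<in> ?J ` {..n}"
      "\<And>j. j \<in> {p..<n} \<Longrightarrow> L j \<subset> L (j + 1)"
    show thesis
    proof (rule that[of L])
      show "L n = UNIV" "L p = P" using L(1,2) J0 Jn by simp_all
      show "\<exists>I. lie_ideal UNIV I \<and> L j = {x + y |x y. x \<in> P \<and> y \<in> I}" if "j \<in> {p..n}" for j
        using L(3)[OF that] I(3) by auto
    qed (use L in auto)
  qed
qed

text \<open>One chain serves both versions of the theorem: its members are subalgebras, and ideals
  if \<open>P\<close> is one. The squeeze gives \<open>lie_index (L j) = 2 * p - j\<close>, hence a
  difference of one between neighbours.\<close>

lemma CP_index_chain:
  assumes "completely_solvable UNIV" and P: "lie_subalgebra P" "commutative P" "dim P = p"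
    and n: "dim (UNIV :: 'a set) = n" and CP: "CP UNIV P"
  obtains L where "L n = UNIV" "L p = P"
    "\<And>j. j \<in> {p..n} \<Longrightarrow> lie_subalgebra (L j) \<and> dim (L j) = j"
    "\<And>j. j \<in> {p..n} \<Longrightarrow> lie_ideal UNIV P \<Longrightarrow> lie_ideal UNIV (L j)"
    "\<And>j. j \<in> {p..<n} \<Longrightarrow> L j \<subset> L (j + 1) \<and> lie_index (L j) = lie_index (L (j + 1)) + 1"
proof -
  have "subspace P" using P(1) by (simp add: lie_subalgebra_def)
  with assms(1) obtain L where L: "L n = UNIV" "L p = P" "\<And>j. j \<in> {p..n} \<Longrightarrow> dim (L j) = j"
    "\<And>j. j \<in> {p..n} \<Longrightarrow> \<exists>I. lie_ideal UNIV I \<and> L j = {x + y |x y. x \<in> P \<and> y \<in> I}"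
    "\<And>j. j \<in> {p..<n} \<Longrightarrow> L j \<subset> L (j + 1)"
    using P(3) n by (rule completely_solvable_chain) blast
  have sub: "lie_subalgebra (L j)" if "j \<in> {p..n}" for j
    using L(4)[OF that] lie_subalgebra_plus_ideal[OF P(1)] by auto
  have index: "lie_index (L j) + j = 2 * p" if j: "j \<in> {p..n}" for j
  proof -
    obtain I where I: "lie_ideal UNIV I" "L j = {x + y |x y. x \<in> P \<and> y \<in> I}"
      using L(4)[OF j] by blast
    have "0 \<in> I" using I(1) subspace_0 by (auto simp: lie_ideal_def)
    then have "P \<subseteq> L j" unfolding I(2) by (force intro: exI[of _ 0])
    then show ?thesis
      using CP_lie_index_between[OF P(1,2) CP lie_subalgebra_UNIV sub[OF j]] L(3)[OF j] P(3) by simp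
  qed
  show ?thesis
  proof (rule that[of L])
    show "lie_ideal UNIV (L j)" if "j \<in> {p..n}" "lie_ideal UNIV P" for j
      using L(4)[OF that(1)] lie_ideal_plus_ideal[OF that(2)] by auto
    show "L j \<subset> L (j + 1) \<and> lie_index (L j) = lie_index (L (j + 1)) + 1" if "j \<in> {p..<n}" for j
      using L(5)[OF that] index[of j] index[of "j + 1"] that by auto
  qed (use L sub in auto)
qed

end

theorem theorem1p11:
  fixes scale :: "'k::field_char_0 \<Rightarrow> 'a::ab_group_add \<Rightarrow> 'a"
    and bracket :: "'a \<Rightarrow> 'a \<Rightarrow> 'a"
    and P :: "'a set" and n p :: nat
  assumes "lie_algebra scale bracket"
    and "lie_algebra.completely_solvable scale bracket UNIV"
    and "vector_space.dim scale (UNIV :: 'a set) = n"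
    and "lie_algebra.lie_subalgebra scale bracket P"
    and "lie_algebra.commutative bracket P"
    and "vector_space.dim scale P = p"
  shows "(lie_algebra.CP scale bracket UNIV P \<longleftrightarrow>
      (\<exists>L :: nat \<Rightarrow> 'a set. L n = UNIV \<and> L p = P \<and>
         (\<forall>j\<in>{p..n}. lie_algebra.lie_subalgebra scale bracket (L j) \<and>
            vector_space.dim scale (L j) = j) \<and>
         (\<forall>j\<in>{p..<n}. L j \<subset> L (j + 1) \<and>
            lie_algebra.lie_index scale bracket (L j) =
              lie_algebra.lie_index scale bracket (L (j + 1)) + 1))) \<and>
    (lie_algebra.CP_ideal scale bracket UNIV P \<longleftrightarrow>
      (\<exists>L :: nat \<Rightarrow> 'a set. L n = UNIV \<and> L p = P \<and>
         (\<forall>j\<in>{p..n}. lie_algebra.lie_ideal scale bracket UNIV (L j) \<and>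
            vector_space.dim scale (L j) = j) \<and>
         (\<forall>j\<in>{p..<n}. L j \<subset> L (j + 1) \<and>
            lie_algebra.lie_index scale bracket (L j) =
              lie_algebra.lie_index scale bracket (L (j + 1)) + 1)))"
proof -
  interpret lie_algebra scale bracket by fact
  note P = assms(4,5,6)
  have pn: "p \<le> n"
  proof -
    obtain B where "finite_dimensional_vector_space scale B" by (rule finite_dimensionalE)
    then interpret F: finite_dimensional_vector_space scale B .
    show ?thesis using F.dim_subset[of P UNIV] assms(3,6) by (simp del: F.dim_UNIV)
  qed
  show ?thesis
  proof (intro conjI iffI)
    assume "CP UNIV P"
    then obtain L where "L n = UNIV" "L p = P"
      "\<And>j. j \<in> {p..n} \<Longrightarrow> lie_subalgebra (L j) \<and> dim (L j) = j"
      "\<And>j. j \<in> {p..<n} \<Longrightarrow> L j \<subset> L (j + 1) \<and> lie_index (L j) = lie_index (L (j + 1)) + 1"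
      using CP_index_chain[OF assms(2) P assms(3)] by metis
    then show "\<exists>L. L n = UNIV \<and> L p = P \<and>
         (\<forall>j\<in>{p..n}. lie_subalgebra (L j) \<and> dim (L j) = j) \<and>
         (\<forall>j\<in>{p..<n}. L j \<subset> L (j + 1) \<and> lie_index (L j) = lie_index (L (j + 1)) + 1)"
      by (intro exI[of _ L] conjI ballI) blast+
  next
    assume "CP_ideal UNIV P"
    then have "CP UNIV P" and ideal: "lie_ideal UNIV P" by (simp_all add: CP_ideal_def)
    then obtain L where "L n = UNIV" "L p = P"
      "\<And>j. j \<in> {p..n} \<Longrightarrow> lie_ideal UNIV (L j) \<and> dim (L j) = j"
      "\<And>j. j \<in> {p..<n} \<Longrightarrow> L j \<subset> L (j + 1) \<and> lie_index (L j) = lie_index (L (j + 1)) + 1"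
      using CP_index_chain[OF assms(2) P assms(3)] by metis
    then show "\<exists>L. L n = UNIV \<and> L p = P \<and>
         (\<forall>j\<in>{p..n}. lie_ideal UNIV (L j) \<and> dim (L j) = j) \<and>
         (\<forall>j\<in>{p..<n}. L j \<subset> L (j + 1) \<and> lie_index (L j) = lie_index (L (j + 1)) + 1)"
      by (intro exI[of _ L] conjI ballI) blast+
  next
    assume "\<exists>L. L n = UNIV \<and> L p = P \<and>
         (\<forall>j\<in>{p..n}. lie_subalgebra (L j) \<and> dim (L j) = j) \<and>
         (\<forall>j\<in>{p..<n}. L j \<subset> L (j + 1) \<and> lie_index (L j) = lie_index (L (j + 1)) + 1)"
    then show "CP UNIV P" using CP_if_index_chain[OF P assms(3)] by blast
  next
    assume *: "\<exists>L. L n = UNIV \<and> L p = P \<and>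
         (\<forall>j\<in>{p..n}. lie_ideal UNIV (L j) \<and> dim (L j) = j) \<and>
         (\<forall>j\<in>{p..<n}. L j \<subset> L (j + 1) \<and> lie_index (L j) = lie_index (L (j + 1)) + 1)"
    then have "CP UNIV P" using CP_if_index_chain[OF P assms(3)] by blast
    \<comment> \<open>Since \<open>p \<le> n\<close>, the series contains its member at
      \<open>j = p\<close>, which is \<open>P\<close> itself.\<close>
    moreover have "lie_ideal UNIV P" using * pn by auto
    ultimately show "CP_ideal UNIV P" by (simp add: CP_ideal_def)
  qed
qed

end
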